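(* Let $\mathfrak C$ be the cost of assembling $\mathtt A$ by localized sum factorization, and $\mathfrak C_{app}$ the cost of computing $\mathtt A\mathbf u$ by localized matrix-free sum factorization, as described in the context. (A) Assembling. Assume $M_{\mathcal D,\delta}\lesssim N_{\mathcal D,\delta}$ for all $\mathcal D\in\mathcal P$ and $\delta=1,\dots,d$. Then: 1. if $\#\mathbb X_{\mathcal D,\delta}\lesssim q_{\mathcal D,\delta}N_{\mathcal D,\delta}+p_{\mathcal D,\delta}M_{\mathcal D,\delta}$ for all $\mathcal D,\delta$, then $\mathfrak C\lesssim R\,p^{d+2}N$; 2. if $\#\mathbb X_{\mathcal D,\delta}\lesssim N_{\mathcal D,\delta}$ for all $\mathcal D,\delta$, then $\mathfrak C\lesssim R\,p^{d+1}N$; 3. if $\#\mathbb X_{\mathcal D,\delta}\gtrsim q_{\mathcal D,\delta}N_{\mathcal D,\delta}+p_{\mathcal D,\delta}M_{\mathcal D,\delta}$ for all $\mathcal D,\delta$, then $\mathfrak C\lesssim p^2\sum_{\mathcal D\in\mathcal P}\#\mathbb X_{\mathcal D}$. (B) Matrix-free application. 1. if $\#\mathbb X_{\mathcal D,\delta}\lesssim p\,M_{\mathcal D,\delta}$ for all $\mathcal D,\delta$, then $\mathfrak C_{app}\lesssim R\,p^{d+1}M$; 2. if $\#\mathbb X_{\mathcal D,\delta}\lesssim M_{\mathcal D,\delta}$ for all $\mathcal D,\delta$, then $\mathfrak C_{app}\lesssim R\,p\,M$; 3. if $\#\mathbb X_{\mathcal D,\delta}\gtrsim M_{\mathcal D,\delta}$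 for all $\mathcal D,\delta$, then $\mathfrak C_{app}\lesssim p\sum_{\mathcal D\in\mathcal P}\#\mathbb X_{\mathcal D}$.
   Context: Setting. $\mathcal P$ is a finite collection of pairwise disjoint $d$-dimensional boxes $\mathcal D=\mathcal D_1\times\dots\times\mathcal D_d$. Each $\mathcal D$ carries a tensor-product quadrature: $\mathbb X_{\mathcal D}=\mathbb X_{\mathcal D,1}\times\dots\times\mathbb X_{\mathcal D,d}$ (finite), $\omega_{\mathcal D}(\mathbf x)=\prod_\delta\omega_{\mathcal D,\delta}(x_\delta)$. $\Phi=(\phi_n)_{n=1}^N$ and $\Psi=(\psi_m)_{m=1}^M$ are families of functions $\bigcup_{\mathcal D\in\mathcal P}\mathcal D\to\mathbb R$, and $\mathtt A$ is the $M\times N$ matrix with entries $\mathtt a(\phi_n,\psi_m)$, $\mathtt a(\phi,\psi)=\sum_{\mathcal D\in\mathcal P}\sum_{\mathbf x\in\mathbb X_{\mathcal D}}\omega_{\mathcal D}(\mathbf x)\mathcal F(\mathbf x)\phi(\mathbf x)\psi(\mathbf x)$ with a given coefficient $\mathcal F$. For each $\mathcal D$, $\Phi_{\mathcal D}$ and $\Psi_{\mathcal D}$ are tensor-product families: they consist of all products of univariate functions from $\Phi_{\mathcal D,\delta}$ ($N_{\mathcal D,\delta}$ functions), respectively $\Psi_{\mathcal D,\delta}$ ($M_{\mathcal D,\delta}$ functions), $\delta=1,\dots,d$, lexicographically ordered; $N_{\mathcal D}=\prod_\delta N_{\mathcal D,\delta}$, $M_{\mathcal D}=\prod_\delta M_{\mathcal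 D,\delta}$. They satisfy $\phi_n|_{\mathcal D}\in\Phi_{\mathcal D}\cup\{0\}$ and $\psi_m|_{\mathcal D}\in\Psi_{\mathcal D}\cup\{0\}$ for all $n,m$. Parameters. $\mathrm{csupp}\,\phi:=\{\alpha\mathbf x+(1-\alpha)\mathbf y:\phi(\mathbf x)\ne0,\phi(\mathbf y)\neq 0,\alpha\in[0,1]\}$; $p_{\mathcal D,\delta}=\max_{x\in\mathbb X_{\mathcal D,\delta}}\#\{\phi\in\Phi_{\mathcal D,\delta}:x\in\mathrm{csupp}\,\phi\}$, and $q_{\mathcal D,\delta}$ is defined in the same way with $\Psi_{\mathcal D,\delta}$; $p=\max_{\mathcal D\in\mathcal P}\max_\delta\max\{p_{\mathcal D,\delta},q_{\mathcal D,\delta}\}$ (with $p\ge1$). Repetition ratio: $R:=\max\big\{\tfrac1N\sum_{\mathcal D\in\mathcal P}N_{\mathcal D},\ \tfrac1M\sum_{\mathcal D\in\mathcal P}M_{\mathcal D}\big\}$. Sum factorization on one box. ASSEMBLE$_d$: if $d=0$ return the value of $\mathcal F$. Otherwise start with the zero $M_{\mathcal D}\times N_{\mathcal D}$ matrix, viewed as an $M_{\mathcal D,d}\times N_{\mathcal D,d}$ array of blocks $B_{m,n}$; for each $x_d\in\mathbb X_{\mathcal D,d}$ compute recursively the matrix $\mathtt A_{x_d}$ of the $(d-1)$-dimensional problem on the first $d-1$ directions with coefficient $\mathcal F(\cdot,x_d)$, and for all $n,m$ such that the $n$-th function $\phi$ of $\Phi_{\mathcal D,d}$ and the $m$-th function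 $\psi$ of $\Psi_{\mathcal D,d}$ do not vanish at $x_d$ update $B_{m,n}\leftarrow B_{m,n}+\omega_{\mathcal D,d}(x_d)\phi(x_d)\psi(x_d)\mathtt A_{x_d}$. APPLY$_d$: the same recursion for the vector with entries $\sum_{\mathbf x\in\mathbb X_{\mathcal D}}\omega_{\mathcal D}(\mathbf x)\psi_{\mathcal D,m}(\mathbf x)\mathcal F(\mathbf x)u(\mathbf x)$, $m=1,\dots,M_{\mathcal D}$, with data $\mathcal Fu$ instead of $\mathcal F$ and with no loop over $n$ and no factor $\phi(x_d)$; here $u=\sum_n\mathbf u_n\phi_n$. Costs on a box are total numbers of scalar entry updates (an update by a matrix costs its number of non-zeros); evaluation of the functions, of $\mathcal F$ and of $u\mathcal F$ at quadrature points is not counted. Localized costs. $\mathtt A=\sum_{\mathcal D}S_{\Psi,\mathcal D}^\top\mathtt A_{\mathcal D}S_{\Phi,\mathcal D}$ with local matrices $\mathtt A_{\mathcal D}$ (for $\Phi_{\mathcal D},\Psi_{\mathcal D},\mathbb X_{\mathcal D}$) and selection matrices $S_{\Phi,\mathcal D},S_{\Psi,\mathcal D}$. $\mathfrak C$ is the sum of the costs of assembling all $\mathtt A_{\mathcal D}$ by ASSEMBLE plus the accumulation cost, i.e. the number of coefficient additions, which is at most of the order of $\sum_{\mathcal D}\#\{(n,m):\mathbb X_{\mathcal D}\cap\mathrm{csupp}\,\phi_{\mathcal D,n}\cap\mathrm{csupp}\,\psi_{\mathcal D,m}\ne\emptyset\}$. $\mathfrak C_{app}$ is the sum of the costs of APPLY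 on all boxes plus the cost of accumulating the local vectors, which is at most of the order of $\sum_{\mathcal D}M_{\mathcal D}$. Notation: $a\lesssim b$ means $a\le c\,b$ with $c>0$ independent of all the sizes $p_{\mathcal D,\delta},q_{\mathcal D,\delta},N_{\mathcal D,\delta},M_{\mathcal D,\delta}$, of $N,M,R$, of the sets $\mathbb X_{\mathcal D,\delta}$ and of $\mathcal P$, but possibly depending on $d$ (and, in implications, on the uniform constants in the hypotheses); $a\gtrsim b$ means $b\lesssim a$. $\#T$ is the number of elements of $T$. *)

theory Defs
  imports "HOL-Analysis.Analysis" "HOL-Library.Disjoint_Sets"
begin

section \<open>Tensor-product data\<close>

text \<open>
  Directions are numbered from 0, so a point of a \<open>k\<close>-dimensional box is an element of
  \<open>{..<k} \<rightarrow>\<^sub>E UNIV\<close>. Univariate families are lists, so repeated functions are counted with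
  repetition. The members of a tensor-product family, and hence the rows and columns of a local
  matrix, are labelled by multi-indices instead of their lexicographic ranks.
\<close>

type_synonym point = "nat \<Rightarrow> real"
type_synonym multi_index = "nat \<Rightarrow> nat"
type_synonym families = "nat \<Rightarrow> (real \<Rightarrow> real) list"

definition indices :: "families \<Rightarrow> nat \<Rightarrow> multi_index set" where
  "indices \<Phi> k = (\<Pi>\<^sub>E \<delta>\<in>{..<k}. {..<length (\<Phi> \<delta>)})"

definition grid :: "(nat \<Rightarrow> real set) \<Rightarrow> nat \<Rightarrow> point set" where
  "grid X k = Pi\<^sub>E {..<k} X"

definition tensor :: "families \<Rightarrow> nat \<Rightarrow> multi_index \<Rightarrow> point \<Rightarrow> real" where
  "tensor \<Phi> k i x = (\<Prod>\<delta><k. (\<Phi> \<delta> ! i \<delta>) (x \<delta>))"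

definition is_box :: "nat \<Rightarrow> point set \<Rightarrow> bool" where
  "is_box d D \<longleftrightarrow> D \<noteq> {} \<and> (\<exists>I. (\<forall>\<delta><d. is_interval (I \<delta>)) \<and> D = Pi\<^sub>E {..<d} I)"

definition side :: "point set \<Rightarrow> nat \<Rightarrow> real set" where
  "side D \<delta> = (\<lambda>x. x \<delta>) ` D"

text \<open>
  Functions are total in HOL; the first set argument is the domain on which the function is
  considered, and values outside of it are ignored.
\<close>

definition csupp :: "real set \<Rightarrow> (real \<Rightarrow> real) \<Rightarrow> real set" where
  "csupp I f = {\<alpha> * x + (1 - \<alpha>) * y | \<alpha> x y.
     x \<in> I \<and> y \<in> I \<and> f x \<noteq> 0 \<and> f y \<noteq> 0 \<and> 0 \<le> \<alpha> \<and> \<alpha> \<le> 1}"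

definition csupp_box :: "nat \<Rightarrow> point set \<Rightarrow> (point \<Rightarrow> real) \<Rightarrow> point set" where
  "csupp_box d D f = {(\<lambda>\<delta>\<in>{..<d}. \<alpha> * x \<delta> + (1 - \<alpha>) * y \<delta>) | \<alpha> x y.
     x \<in> D \<and> y \<in> D \<and> f x \<noteq> 0 \<and> f y \<noteq> 0 \<and> 0 \<le> \<alpha> \<and> \<alpha> \<le> 1}"

text \<open>On \<open>nat\<close>, the supremum of a finite set is its maximum, and that of the empty set is 0.\<close>

definition overlap :: "real set \<Rightarrow> real set \<Rightarrow> (real \<Rightarrow> real) list \<Rightarrow> nat" where
  "overlap I X \<phi> = (SUP x\<in>X. card {i. i < length \<phi> \<and> x \<in> csupp I (\<phi> ! i)})"


section \<open>Sum factorization on one box\<close>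

text \<open>
  Both algorithms return the computed matrix or vector together with the number of scalar entry
  updates. At level 0 the coefficient is a function on the single point of \<open>{} \<rightarrow>\<^sub>E UNIV\<close>, which
  is \<open>\<lambda>_. undefined\<close>. At level \<open>Suc k\<close>, entry \<open>(m, n)\<close> lies in the block \<open>(m k, n k)\<close>, at the
  position given by the restrictions of \<open>m\<close> and \<open>n\<close> to \<open>{..<k}\<close>.
\<close>

definition nnz ::
    "families \<Rightarrow> families \<Rightarrow> nat \<Rightarrow> (multi_index \<Rightarrow> multi_index \<Rightarrow> real) \<Rightarrow> nat" where
  "nnz \<Phi> \<Psi> k A = card {(m, n). m \<in> indices \<Psi> k \<and> n \<in> indices \<Phi> k \<and> A m n \<noteq> 0}"

definition active :: "(real \<Rightarrow> real) list \<Rightarrow> real \<Rightarrow> nat set" where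
  "active \<phi> x = {i. i < length \<phi> \<and> (\<phi> ! i) x \<noteq> 0}"

primrec assemble ::
    "(nat \<Rightarrow> real set) \<Rightarrow> (nat \<Rightarrow> real \<Rightarrow> real) \<Rightarrow> families \<Rightarrow> families \<Rightarrow> nat \<Rightarrow> (point \<Rightarrow> real)
      \<Rightarrow> (multi_index \<Rightarrow> multi_index \<Rightarrow> real) \<times> nat" where
  "assemble X \<omega> \<Phi> \<Psi> 0 F = ((\<lambda>m n. F (\<lambda>_. undefined)), 0)"
| "assemble X \<omega> \<Phi> \<Psi> (Suc k) F =
    (let rec = (\<lambda>x. assemble X \<omega> \<Phi> \<Psi> k (\<lambda>y. F (y(k := x))))
     in ((\<lambda>m n. \<Sum>x\<in>X k.
            if m k \<in> active (\<Psi> k) x \<and> n k \<in> active (\<Phi> k) x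
            then \<omega> k x * (\<Phi> k ! n k) x * (\<Psi> k ! m k) x
                   * fst (rec x) (restrict m {..<k}) (restrict n {..<k})
            else 0),
         \<Sum>x\<in>X k. snd (rec x)
            + card (active (\<Psi> k) x \<times> active (\<Phi> k) x) * nnz \<Phi> \<Psi> k (fst (rec x))))"

text \<open>
  The local vectors are treated as dense: an update by a vector costs its length, which dominates
  its number of non-zeros.
\<close>

primrec apply_sf ::
    "(nat \<Rightarrow> real set) \<Rightarrow> (nat \<Rightarrow> real \<Rightarrow> real) \<Rightarrow> families \<Rightarrow> nat \<Rightarrow> (point \<Rightarrow> real)
      \<Rightarrow> (multi_index \<Rightarrow> real) \<times> nat" where
  "apply_sf X \<omega> \<Psi> 0 G = ((\<lambda>m. G (\<lambda>_. undefined)), 0)"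
| "apply_sf X \<omega> \<Psi> (Suc k) G =
    (let rec = (\<lambda>x. apply_sf X \<omega> \<Psi> k (\<lambda>y. G (y(k := x))))
     in ((\<lambda>m. \<Sum>x\<in>X k.
            if m k \<in> active (\<Psi> k) x
            then \<omega> k x * (\<Psi> k ! m k) x * fst (rec x) (restrict m {..<k})
            else 0),
         \<Sum>x\<in>X k. snd (rec x) + card (active (\<Psi> k) x) * card (indices \<Psi> k)))"

lemma sum_grid_Suc:
  fixes f :: "point \<Rightarrow> real"
  shows "(\<Sum>y\<in>grid X (Suc k). f y) = (\<Sum>x\<in>X k. \<Sum>y\<in>grid X k. f (y(k := x)))"
proof -
  have "grid X (Suc k) = (\<lambda>(x, y). y(k := x)) ` (X k \<times> grid X k)"
    unfolding grid_def lessThan_Suc by (rule PiE_insert_eq)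
  moreover have "inj_on (\<lambda>(x, y). y(k := x)) (X k \<times> grid X k)"
    unfolding grid_def by (rule inj_combinator) simp
  ultimately show ?thesis
    by (simp add: sum.reindex sum.cartesian_product case_prod_unfold)
qed

lemma prod_upd_lessThan:
  fixes g :: "nat \<Rightarrow> real \<Rightarrow> real"
  shows "(\<Prod>\<delta><k. g \<delta> ((y(k := x)) \<delta>)) = (\<Prod>\<delta><k. g \<delta> (y \<delta>))"
  by (rule prod.cong) auto

lemma tensor_Suc_upd:
  "tensor \<Phi> (Suc k) i (y(k := x)) = (\<Phi> k ! i k) x * tensor \<Phi> k (restrict i {..<k}) y"
proof -
  have "(\<Prod>\<delta><k. (\<Phi> \<delta> ! i \<delta>) ((y(k := x)) \<delta>))
      = (\<Prod>\<delta><k. (\<Phi> \<delta> ! restrict i {..<k} \<delta>) (y \<delta>))"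
    by (rule prod.cong) auto
  then show ?thesis
    by (simp add: tensor_def)
qed

lemma restrict_indices: "i \<in> indices \<Phi> (Suc k) \<Longrightarrow> restrict i {..<k} \<in> indices \<Phi> k"
  by (auto simp: indices_def PiE_iff)

lemma assemble_correct:
  assumes "m \<in> indices \<Psi> k" "n \<in> indices \<Phi> k"
  shows "fst (assemble X \<omega> \<Phi> \<Psi> k F) m n
    = (\<Sum>x\<in>grid X k. (\<Prod>\<delta><k. \<omega> \<delta> (x \<delta>)) * F x * tensor \<Phi> k n x * tensor \<Psi> k m x)"
  using assms
proof (induction k arbitrary: F m n)
  case 0
  then show ?case by (simp add: grid_def tensor_def)
next
  case (Suc k)
  define m' n' where "m' = restrict m {..<k}" and "n' = restrict n {..<k}"
  have IH: "fst (assemble X \<omega> \<Phi> \<Psi> k F) m' n'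
      = (\<Sum>x\<in>grid X k. (\<Prod>\<delta><k. \<omega> \<delta> (x \<delta>)) * F x * tensor \<Phi> k n' x * tensor \<Psi> k m' x)" for F
    unfolding m'_def n'_def using Suc.prems by (intro Suc.IH restrict_indices)
  have "m k < length (\<Psi> k)" "n k < length (\<Phi> k)"
    using Suc.prems by (auto simp: indices_def PiE_iff)
  then show ?case
    by (auto simp: Let_def sum_grid_Suc active_def tensor_Suc_upd prod_upd_lessThan IH
        m'_def[symmetric] n'_def[symmetric] sum_distrib_left mult_ac intro!: sum.cong)
qed

lemma apply_sf_correct:
  assumes "m \<in> indices \<Psi> k"
  shows "fst (apply_sf X \<omega> \<Psi> k G) m
    = (\<Sum>x\<in>grid X k. (\<Prod>\<delta><k. \<omega> \<delta> (x \<delta>)) * G x * tensor \<Psi> k m x)"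
  using assms
proof (induction k arbitrary: G m)
  case 0
  then show ?case by (simp add: grid_def tensor_def)
next
  case (Suc k)
  define m' where "m' = restrict m {..<k}"
  have IH: "fst (apply_sf X \<omega> \<Psi> k G) m'
      = (\<Sum>x\<in>grid X k. (\<Prod>\<delta><k. \<omega> \<delta> (x \<delta>)) * G x * tensor \<Psi> k m' x)" for G
    unfolding m'_def using Suc.prems by (intro Suc.IH restrict_indices)
  have "m k < length (\<Psi> k)"
    using Suc.prems by (auto simp: indices_def PiE_iff)
  then show ?case
    by (auto simp: Let_def sum_grid_Suc active_def tensor_Suc_upd prod_upd_lessThan IH
        m'_def[symmetric] sum_distrib_left mult_ac intro!: sum.cong)
qed


section \<open>Localized sum factorization\<close>

record setting =
  boxes :: "point set set"
  quad :: "point set \<Rightarrow> nat \<Rightarrow> real set"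
  weight :: "point set \<Rightarrow> nat \<Rightarrow> real \<Rightarrow> real"
  locPhi :: "point set \<Rightarrow> families"
  locPsi :: "point set \<Rightarrow> families"
  Phi :: "(point \<Rightarrow> real) list"
  Psi :: "(point \<Rightarrow> real) list"

definition dimPhi :: "nat \<Rightarrow> setting \<Rightarrow> point set \<Rightarrow> nat" where
  "dimPhi d S D = (\<Prod>\<delta><d. length (locPhi S D \<delta>))"

definition dimPsi :: "nat \<Rightarrow> setting \<Rightarrow> point set \<Rightarrow> nat" where
  "dimPsi d S D = (\<Prod>\<delta><d. length (locPsi S D \<delta>))"

definition p_loc :: "setting \<Rightarrow> point set \<Rightarrow> nat \<Rightarrow> nat" where
  "p_loc S D \<delta> = overlap (side D \<delta>) (quad S D \<delta>) (locPhi S D \<delta>)"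

definition q_loc :: "setting \<Rightarrow> point set \<Rightarrow> nat \<Rightarrow> nat" where
  "q_loc S D \<delta> = overlap (side D \<delta>) (quad S D \<delta>) (locPsi S D \<delta>)"

definition p_max :: "nat \<Rightarrow> setting \<Rightarrow> nat" where
  "p_max d S = (SUP D\<in>boxes S. SUP \<delta>\<in>{..<d}. max (p_loc S D \<delta>) (q_loc S D \<delta>))"

definition rep_ratio :: "nat \<Rightarrow> setting \<Rightarrow> real" where
  "rep_ratio d S = max
     (1 / real (length (Phi S)) * (\<Sum>D\<in>boxes S. real (dimPhi d S D)))
     (1 / real (length (Psi S)) * (\<Sum>D\<in>boxes S. real (dimPsi d S D)))"

definition restricts_to :: "nat \<Rightarrow> point set \<Rightarrow> families \<Rightarrow> (point \<Rightarrow> real) \<Rightarrow> bool" where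
  "restricts_to d D \<Phi> f \<longleftrightarrow>
     (\<exists>i\<in>indices \<Phi> d. \<forall>x\<in>D. f x = tensor \<Phi> d i x) \<or> (\<forall>x\<in>D. f x = 0)"

definition admissible :: "nat \<Rightarrow> setting \<Rightarrow> bool" where
  "admissible d S \<longleftrightarrow>
     finite (boxes S) \<and> disjoint (boxes S) \<and>
     (\<forall>D\<in>boxes S.
        is_box d D \<and>
        (\<forall>\<delta><d. finite (quad S D \<delta>) \<and> quad S D \<delta> \<subseteq> side D \<delta>) \<and>
        (\<forall>\<phi>\<in>set (Phi S). restricts_to d D (locPhi S D) \<phi>) \<and>
        (\<forall>\<psi>\<in>set (Psi S). restricts_to d D (locPsi S D) \<psi>)) \<and>
     length (Phi S) \<ge> 1 \<and> length (Psi S) \<ge> 1 \<and> p_max d S \<ge> 1"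

definition loc_assemble ::
    "nat \<Rightarrow> setting \<Rightarrow> (point \<Rightarrow> real) \<Rightarrow> point set
      \<Rightarrow> (multi_index \<Rightarrow> multi_index \<Rightarrow> real) \<times> nat" where
  "loc_assemble d S F D =
     assemble (quad S D) (weight S D) (locPhi S D) (locPsi S D) d F"

definition loc_apply ::
    "nat \<Rightarrow> setting \<Rightarrow> (point \<Rightarrow> real) \<Rightarrow> (nat \<Rightarrow> real) \<Rightarrow> point set
      \<Rightarrow> (multi_index \<Rightarrow> real) \<times> nat" where
  "loc_apply d S F u D =
     apply_sf (quad S D) (weight S D) (locPsi S D) d
       (\<lambda>x. F x * (\<Sum>n<length (Phi S). u n * (Phi S ! n) x))"

definition interacting :: "nat \<Rightarrow> setting \<Rightarrow> point set \<Rightarrow> (multi_index \<times> multi_index) set" where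
  "interacting d S D =
     {(n, m). n \<in> indices (locPhi S D) d \<and> m \<in> indices (locPsi S D) d \<and>
        grid (quad S D) d
          \<inter> csupp_box d D (tensor (locPhi S D) d n)
          \<inter> csupp_box d D (tensor (locPsi S D) d m) \<noteq> {}}"

text \<open>
  The accumulation cost \<open>acc\<close> is only specified up to its order of magnitude; it enters the total
  costs as an arbitrary number subject to the bounds below.
\<close>

definition acc_assemble_bound :: "real \<Rightarrow> nat \<Rightarrow> setting \<Rightarrow> nat \<Rightarrow> bool" where
  "acc_assemble_bound c d S acc \<longleftrightarrow>
     real acc \<le> c * (\<Sum>D\<in>boxes S. real (card (interacting d S D)))"

definition acc_apply_bound :: "real \<Rightarrow> nat \<Rightarrow> setting \<Rightarrow> nat \<Rightarrow> bool" where
  "acc_apply_bound c d S acc \<longleftrightarrow>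
     real acc \<le> c * (\<Sum>D\<in>boxes S. real (dimPsi d S D))"

definition cost_assemble :: "nat \<Rightarrow> setting \<Rightarrow> (point \<Rightarrow> real) \<Rightarrow> nat \<Rightarrow> nat" where
  "cost_assemble d S F acc = (\<Sum>D\<in>boxes S. snd (loc_assemble d S F D)) + acc"

definition cost_apply ::
    "nat \<Rightarrow> setting \<Rightarrow> (point \<Rightarrow> real) \<Rightarrow> (nat \<Rightarrow> real) \<Rightarrow> nat \<Rightarrow> nat" where
  "cost_apply d S F u acc = (\<Sum>D\<in>boxes S. snd (loc_apply d S F u D)) + acc"

definition system_matrix :: "nat \<Rightarrow> setting \<Rightarrow> (point \<Rightarrow> real) \<Rightarrow> nat \<Rightarrow> nat \<Rightarrow> real" where
  "system_matrix d S F m n = (\<Sum>D\<in>boxes S. \<Sum>x\<in>grid (quad S D) d.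
     (\<Prod>\<delta><d. weight S D \<delta> (x \<delta>)) * F x * (Phi S ! n) x * (Psi S ! m) x)"

lemma grid_subset_box:
  assumes "admissible d S" "D \<in> boxes S"
  shows "grid (quad S D) d \<subseteq> D"
proof -
  have box: "is_box d D" and quad: "\<And>\<delta>. \<delta> < d \<Longrightarrow> quad S D \<delta> \<subseteq> side D \<delta>"
    using assms by (simp_all add: admissible_def)
  obtain I where I: "D = Pi\<^sub>E {..<d} I"
    using box unfolding is_box_def by blast
  have "quad S D \<delta> \<subseteq> I \<delta>" if "\<delta> < d" for \<delta>
    using quad[OF that] that by (auto simp: side_def I PiE_iff)
  then show ?thesis
    unfolding grid_def I by (intro PiE_mono) simp
qed

text \<open>
  The localized representation of the system matrix, with selection matrices \<open>T\<close> (for \<open>Psi\<close>) and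
  \<open>R\<close> (for \<open>Phi\<close>).
\<close>

lemma system_matrix_localized:
  assumes adm: "admissible d S"
    and Phi: "\<And>D x. D \<in> boxes S \<Longrightarrow> x \<in> D \<Longrightarrow>
      (Phi S ! n) x = (\<Sum>i\<in>indices (locPhi S D) d. R D i n * tensor (locPhi S D) d i x)"
    and Psi: "\<And>D x. D \<in> boxes S \<Longrightarrow> x \<in> D \<Longrightarrow>
      (Psi S ! m) x = (\<Sum>j\<in>indices (locPsi S D) d. T D j m * tensor (locPsi S D) d j x)"
  shows "system_matrix d S F m n =
    (\<Sum>D\<in>boxes S. \<Sum>j\<in>indices (locPsi S D) d. \<Sum>i\<in>indices (locPhi S D) d.
       T D j m * fst (loc_assemble d S F D) j i * R D i n)"
proof -
  have "(\<Sum>x\<in>grid (quad S D) d.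
          (\<Prod>\<delta><d. weight S D \<delta> (x \<delta>)) * F x * (Phi S ! n) x * (Psi S ! m) x)
      = (\<Sum>j\<in>indices (locPsi S D) d. \<Sum>i\<in>indices (locPhi S D) d.
          T D j m * fst (loc_assemble d S F D) j i * R D i n)"
    (is "?L = ?R") if D: "D \<in> boxes S" for D
  proof -
    let ?w = "\<lambda>x. (\<Prod>\<delta><d. weight S D \<delta> (x \<delta>)) * F x"
    let ?I = "indices (locPhi S D) d" and ?J = "indices (locPsi S D) d"
    let ?a = "\<lambda>i. tensor (locPhi S D) d i" and ?b = "\<lambda>j. tensor (locPsi S D) d j"
    have "?L = (\<Sum>x\<in>grid (quad S D) d. \<Sum>j\<in>?J. \<Sum>i\<in>?I.
        T D j m * (?w x * ?a i x * ?b j x) * R D i n)"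
    proof (rule sum.cong[OF refl])
      fix x assume "x \<in> grid (quad S D) d"
      then have "x \<in> D" using grid_subset_box[OF adm D] by auto
      then show "?w x * (Phi S ! n) x * (Psi S ! m) x
          = (\<Sum>j\<in>?J. \<Sum>i\<in>?I. T D j m * (?w x * ?a i x * ?b j x) * R D i n)"
        by (simp add: Phi[OF D] Psi[OF D] sum_product sum_distrib_left mult_ac)
           (rule sum.swap)
    qed
    also have "\<dots> = (\<Sum>j\<in>?J. \<Sum>x\<in>grid (quad S D) d. \<Sum>i\<in>?I.
        T D j m * (?w x * ?a i x * ?b j x) * R D i n)"
      by (rule sum.swap)
    also have "\<dots> = (\<Sum>j\<in>?J. \<Sum>i\<in>?I. \<Sum>x\<in>grid (quad S D) d.
        T D j m * (?w x * ?a i x * ?b j x) * R D i n)"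
      by (intro sum.cong refl sum.swap)
    also have "\<dots> = ?R"
      by (intro sum.cong refl)
        (simp add: loc_assemble_def assemble_correct sum_distrib_left sum_distrib_right mult_ac)
    finally show ?thesis .
  qed
  then show ?thesis
    by (simp add: system_matrix_def)
qed

end

theory Submission
  imports Defs
begin

text \<open>
  On one box both algorithms have the same cost structure. Unrolling the recursion, the updates
  made at level \<open>k\<close> are performed once for every choice of quadrature points in the directions
  \<open>k, \<dots>, d - 1\<close>, they touch at most \<open>p\<close> (for a vector) or \<open>p\<^sup>2\<close> (for a matrix) blocks, and each
  of these blocks has at most \<open>v\<^sub>0 \<cdots> v\<^sub>k\<^sub>-\<^sub>1\<close> entries to update, where \<open>v\<^sub>\<delta>\<close> bounds the number of
  relevant univariate indices (or pairs of indices) in direction \<open>\<delta>\<close>. With \<open>x\<^sub>\<delta>\<close> quadrature points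
  in direction \<open>\<delta>\<close> the cost is therefore at most \<open>p\<close> or \<open>p\<^sup>2\<close> times
  \<open>\<Sum>k<d. x\<^sub>d\<^sub>-\<^sub>1 \<cdots> x\<^sub>k * v\<^sub>k\<^sub>-\<^sub>1 \<cdots> v\<^sub>0\<close>, called \<open>sweep\<close> below; see \<open>snd_assemble_le\<close> and
  \<open>snd_apply_sf_le\<close>.

  For APPLY, \<open>v\<^sub>\<delta>\<close> is simply the number \<open>M\<^sub>\<delta>\<close> of test functions. For ASSEMBLE the point is that
  sparsity gives \<open>v\<^sub>\<delta> = q\<^sub>\<delta> N\<^sub>\<delta> + p\<^sub>\<delta> M\<^sub>\<delta>\<close> instead of \<open>N\<^sub>\<delta> M\<^sub>\<delta>\<close>: convex supports on a line are
  intervals, and if two intervals share a quadrature point, then the first quadrature point of one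
  of them belongs to the other. Charging each pair to that point, every trial function is charged
  at most \<open>q\<^sub>\<delta>\<close> times and every test function at most \<open>p\<^sub>\<delta>\<close> times (\<open>card_meeting_intervals\<close>). A
  non-zero entry of a local matrix needs a point at which all univariate factors are non-zero, so
  its index pair meets in every direction, and the same holds for the pairs that are accumulated.

  What remains is to compare \<open>x\<^sub>\<delta>\<close> and \<open>v\<^sub>\<delta>\<close> with a common size \<open>t\<^sub>\<delta>\<close>, up to powers of the
  maximal overlap \<open>p\<close>: \<open>x\<^sub>\<delta> \<lesssim> p\<^sup>\<alpha> t\<^sub>\<delta>\<close> and \<open>v\<^sub>\<delta> \<lesssim> p\<^sup>\<beta> t\<^sub>\<delta>\<close>. The summand of \<open>sweep\<close> with index
  \<open>k\<close> is then at most of the order of \<open>p\<close> to the power \<open>\<alpha> (d - k) + \<beta> k\<close> times \<open>t\<^sub>0 \<cdots> t\<^sub>d\<^sub>-\<^sub>1\<close>.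
  The six claims are the choices \<open>(\<alpha>, \<beta>) = (1, 1), (0, 1), (0, 0)\<close> for assembling, with
  \<open>t = N, N, x\<close>, and \<open>(1, 0), (0, 0), (0, 0)\<close> for applying, with \<open>t = M, M, x\<close>. In the second claim
  the index \<open>k\<close> never reaches \<open>d\<close>, and this saves one power of \<open>p\<close> over the first. The repetition
  ratio enters only through \<open>\<Sum>\<^sub>D N\<^sub>D \<le> R N\<close> and \<open>\<Sum>\<^sub>D M\<^sub>D \<le> R M\<close>.
\<close>

section \<open>Overlaps of univariate families\<close>

lemma csupp_iff:
  "z \<in> csupp I f \<longleftrightarrow> (\<exists>x\<in>I. \<exists>y\<in>I. f x \<noteq> 0 \<and> f y \<noteq> 0 \<and> x \<le> z \<and> z \<le> y)"
proof
  assume "z \<in> csupp I f"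
  then obtain \<alpha> x y where z: "z = \<alpha> * x + (1 - \<alpha>) * y" "0 \<le> \<alpha>" "\<alpha> \<le> 1"
    and xy: "x \<in> I" "y \<in> I" "f x \<noteq> 0" "f y \<noteq> 0"
    unfolding csupp_def by blast
  have "z \<in> closed_segment y x"
    unfolding in_segment using z by (auto intro!: exI[of _ \<alpha>])
  then have "x \<le> z \<and> z \<le> y \<or> y \<le> z \<and> z \<le> x"
    by (auto simp: closed_segment_eq_real_ivl split: if_splits)
  then show "\<exists>x\<in>I. \<exists>y\<in>I. f x \<noteq> 0 \<and> f y \<noteq> 0 \<and> x \<le> z \<and> z \<le> y"
    using xy by blast
next
  assume "\<exists>x\<in>I. \<exists>y\<in>I. f x \<noteq> 0 \<and> f y \<noteq> 0 \<and> x \<le> z \<and> z \<le> y"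
  then obtain x y where xy: "x \<in> I" "y \<in> I" "f x \<noteq> 0" "f y \<noteq> 0" "x \<le> z" "z \<le> y"
    by blast
  then have "z \<in> closed_segment y x"
    by (simp add: closed_segment_eq_real_ivl)
  then obtain u where "z = u * x + (1 - u) * y" "0 \<le> u" "u \<le> 1"
    unfolding in_segment by (auto simp: add.commute)
  then show "z \<in> csupp I f"
    unfolding csupp_def using xy by blast
qed

lemma csupp_self: "x \<in> I \<Longrightarrow> f x \<noteq> 0 \<Longrightarrow> x \<in> csupp I f"
  unfolding csupp_iff by blast

lemma csupp_convex: "u \<in> csupp I f \<Longrightarrow> w \<in> csupp I f \<Longrightarrow> u \<le> v \<Longrightarrow> v \<le> w \<Longrightarrow> v \<in> csupp I f"
  unfolding csupp_iff by (meson order_trans)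

lemma card_le_overlap:
  assumes "finite X" "x \<in> X"
  shows "card {i. i < length \<phi> \<and> x \<in> csupp I (\<phi> ! i)} \<le> overlap I X \<phi>"
  unfolding overlap_def using assms by (intro cSUP_upper bdd_above_finite) auto

lemma card_active_le_overlap:
  assumes "finite X" "X \<subseteq> I" "x \<in> X"
  shows "card (active \<phi> x) \<le> overlap I X \<phi>"
proof -
  have "active \<phi> x \<subseteq> {i. i < length \<phi> \<and> x \<in> csupp I (\<phi> ! i)}"
    using assms by (auto simp: active_def intro: csupp_self)
  then have "card (active \<phi> x) \<le> card {i. i < length \<phi> \<and> x \<in> csupp I (\<phi> ! i)}"
    by (intro card_mono) auto
  also have "\<dots> \<le> overlap I X \<phi>"
    using assms by (intro card_le_overlap)
  finally show ?thesis .
qed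

text \<open>
  If two intervals meet in \<open>X\<close>, the larger of their two first points in \<open>X\<close> lies in both. So every
  meeting pair is found by listing, for each interval, the intervals of the other family that
  contain its first point.
\<close>

lemma card_meeting_intervals:
  fixes X :: "'a::linorder set" and A :: "'i \<Rightarrow> 'a set" and B :: "'j \<Rightarrow> 'a set"
  assumes fin: "finite X" "finite I" "finite J"
    and A: "\<And>i u v w. \<lbrakk>u \<in> A i; w \<in> A i; u \<le> v; v \<le> w\<rbrakk> \<Longrightarrow> v \<in> A i"
    and B: "\<And>j u v w. \<lbrakk>u \<in> B j; w \<in> B j; u \<le> v; v \<le> w\<rbrakk> \<Longrightarrow> v \<in> B j"
    and p: "\<And>x. x \<in> X \<Longrightarrow> card {i\<in>I. x \<in> A i} \<le> p"
    and q: "\<And>x. x \<in> X \<Longrightarrow> card {j\<in>J. x \<in> B j} \<le> q"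
  shows "card {(i, j). i \<in> I \<and> j \<in> J \<and> (\<exists>x\<in>X. x \<in> A i \<and> x \<in> B j)}
    \<le> q * card I + p * card J"
proof -
  define a where "a i = Min (X \<inter> A i)" for i
  define b where "b j = Min (X \<inter> B j)" for j
  define I' where "I' = {i\<in>I. X \<inter> A i \<noteq> {}}"
  define J' where "J' = {j\<in>J. X \<inter> B j \<noteq> {}}"
  define S1 where "S1 = (SIGMA i:I'. {j\<in>J. a i \<in> B j})"
  define S2 where "S2 = (SIGMA j:J'. {i\<in>I. b j \<in> A i})"
  have a: "a i \<in> X \<inter> A i" "\<And>x. x \<in> X \<inter> A i \<Longrightarrow> a i \<le> x" if "i \<in> I'" for i
    using that fin Min_in[of "X \<inter> A i"] by (auto simp: a_def I'_def)
  have b: "b j \<in> X \<inter> B j" "\<And>x. x \<in> X \<inter> B j \<Longrightarrow> b j \<le> x" if "j \<in> J'" for j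
    using that fin Min_in[of "X \<inter> B j"] by (auto simp: b_def J'_def)
  have finS: "finite S1" "finite S2"
    using fin by (auto simp: S1_def S2_def I'_def J'_def)
  have sub: "{(i, j). i \<in> I \<and> j \<in> J \<and> (\<exists>x\<in>X. x \<in> A i \<and> x \<in> B j)} \<subseteq> S1 \<union> prod.swap ` S2"
  proof clarify
    fix i j x
    assume *: "i \<in> I" "j \<in> J" "x \<in> X" "x \<in> A i" "x \<in> B j" "(i, j) \<notin> prod.swap ` S2"
    have i: "i \<in> I'" and j: "j \<in> J'" using * by (auto simp: I'_def J'_def)
    have "b j \<notin> A i"
      using * j by (force simp: S2_def image_iff)
    then have "b j \<le> a i"
      using A[of "a i" i x "b j"] a[OF i] b[OF j] * by (metis IntD2 IntI linear)
    then have "a i \<in> B j"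
      using B[of "b j" j x "a i"] a[OF i] b[OF j] * by blast
    then show "(i, j) \<in> S1" using i * by (auto simp: S1_def)
  qed
  have "card S1 = (\<Sum>i\<in>I'. card {j\<in>J. a i \<in> B j})"
    unfolding S1_def using fin by (intro card_SigmaI) (auto simp: I'_def)
  also have "\<dots> \<le> card I' * q"
    using a by (intro sum_bounded_above[of _ _ q, simplified]) (auto intro: q)
  also have "\<dots> \<le> card I * q"
    using fin by (intro mult_right_mono card_mono) (auto simp: I'_def)
  finally have S1: "card S1 \<le> card I * q" .
  have "card S2 = (\<Sum>j\<in>J'. card {i\<in>I. b j \<in> A i})"
    unfolding S2_def using fin by (intro card_SigmaI) (auto simp: J'_def)
  also have "\<dots> \<le> card J' * p"
    using b by (intro sum_bounded_above[of _ _ p, simplified]) (auto intro: p)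
  also have "\<dots> \<le> card J * p"
    using fin by (intro mult_right_mono card_mono) (auto simp: J'_def)
  finally have S2: "card S2 \<le> card J * p" .
  have "card {(i, j). i \<in> I \<and> j \<in> J \<and> (\<exists>x\<in>X. x \<in> A i \<and> x \<in> B j)}
      \<le> card (S1 \<union> prod.swap ` S2)"
    using sub finS by (intro card_mono) auto
  also have "\<dots> \<le> card S1 + card (prod.swap ` S2)"
    by (rule card_Un_le)
  also have "\<dots> \<le> card S1 + card S2"
    using finS by (intro add_left_mono card_image_le)
  finally show ?thesis
    using S1 S2 by (simp add: mult.commute)
qed

definition meeting ::
    "real set \<Rightarrow> real set \<Rightarrow> (real \<Rightarrow> real) list \<Rightarrow> (real \<Rightarrow> real) list \<Rightarrow> (nat \<times> nat) set" where
  "meeting I X \<phi> \<psi> = {(i, j). i \<in> {..<length \<phi>} \<and> j \<in> {..<length \<psi>} \<and>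
     (\<exists>x\<in>X. x \<in> csupp I (\<phi> ! i) \<and> x \<in> csupp I (\<psi> ! j))}"

lemma finite_meeting: "finite (meeting I X \<phi> \<psi>)"
  by (rule finite_subset[of _ "{..<length \<phi>} \<times> {..<length \<psi>}"]) (auto simp: meeting_def)

lemma card_meeting_le:
  assumes "finite X"
  shows "card (meeting I X \<phi> \<psi>) \<le> overlap I X \<psi> * length \<phi> + overlap I X \<phi> * length \<psi>"
proof -
  have "card (meeting I X \<phi> \<psi>)
      \<le> overlap I X \<psi> * card {..<length \<phi>} + overlap I X \<phi> * card {..<length \<psi>}"
    unfolding meeting_def using card_le_overlap[OF assms]
    by (intro card_meeting_intervals assms) (auto intro: csupp_convex)
  then show ?thesis by simp
qed

section \<open>Multi-indices that interact in every direction\<close>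

lemma card_indices: "card (indices \<Phi> k) = (\<Prod>\<delta><k. length (\<Phi> \<delta>))"
  by (simp add: indices_def card_PiE)

text \<open>
  Pairing the entries of two multi-indices direction by direction is injective, so a bound on the
  number of related univariate indices in each direction multiplies up.
\<close>

lemma card_index_pairs_le:
  assumes sub: "S \<subseteq> indices \<Phi> k \<times> indices \<Psi> k"
    and Q: "\<And>m n \<delta>. (m, n) \<in> S \<Longrightarrow> \<delta> < k \<Longrightarrow> (m \<delta>, n \<delta>) \<in> Q \<delta>"
    and fin: "\<And>\<delta>. \<delta> < k \<Longrightarrow> finite (Q \<delta>)"
    and card: "\<And>\<delta>. \<delta> < k \<Longrightarrow> card (Q \<delta>) \<le> v \<delta>"
  shows "card S \<le> (\<Prod>\<delta><k. v \<delta>)"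
proof -
  let ?z = "\<lambda>(m, n). \<lambda>\<delta>\<in>{..<k}. (m \<delta>, n \<delta>)"
  have "inj_on ?z S"
  proof (rule inj_onI, clarify)
    fix m n m' n'
    assume S: "(m, n) \<in> S" "(m', n') \<in> S"
      and eq: "(\<lambda>\<delta>\<in>{..<k}. (m \<delta>, n \<delta>)) = (\<lambda>\<delta>\<in>{..<k}. (m' \<delta>, n' \<delta>))"
    have "m \<delta> = m' \<delta> \<and> n \<delta> = n' \<delta>" if "\<delta> < k" for \<delta>
      using fun_cong[OF eq, of \<delta>] that by simp
    moreover have "m \<in> indices \<Phi> k" "m' \<in> indices \<Phi> k" "n \<in> indices \<Psi> k" "n' \<in> indices \<Psi> k"
      using S sub by auto
    ultimately show "m = m' \<and> n = n'"
      unfolding indices_def by (auto intro: PiE_ext)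
  qed
  then have "card S = card (?z ` S)"
    by (simp add: card_image)
  also have "\<dots> \<le> card (Pi\<^sub>E {..<k} Q)"
    using Q fin by (intro card_mono finite_PiE) (auto simp: PiE_iff split: if_splits)
  also have "\<dots> = (\<Prod>\<delta><k. card (Q \<delta>))"
    by (simp add: card_PiE)
  also have "\<dots> \<le> (\<Prod>\<delta><k. v \<delta>)"
    using card by (intro prod_mono) auto
  finally show ?thesis .
qed

text \<open>
  An entry is a sum over quadrature points of products of univariate values, so a non-zero entry
  exhibits one quadrature point whose coordinate in each direction is a meeting point of the two
  univariate functions.
\<close>

lemma nnz_assemble_le:
  assumes "\<And>\<delta>. \<delta> < k \<Longrightarrow> finite (X \<delta>)" "\<And>\<delta>. \<delta> < k \<Longrightarrow> X \<delta> \<subseteq> I \<delta>"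
  shows "nnz \<Phi> \<Psi> k (fst (assemble X \<omega> \<Phi> \<Psi> k F))
    \<le> (\<Prod>\<delta><k. overlap (I \<delta>) (X \<delta>) (\<Psi> \<delta>) * length (\<Phi> \<delta>)
              + overlap (I \<delta>) (X \<delta>) (\<Phi> \<delta>) * length (\<Psi> \<delta>))"
  unfolding nnz_def
proof (rule card_index_pairs_le)
  fix m n \<delta>
  assume "(m, n) \<in> {(m, n). m \<in> indices \<Psi> k \<and> n \<in> indices \<Phi> k
            \<and> fst (assemble X \<omega> \<Phi> \<Psi> k F) m n \<noteq> 0}" and \<delta>: "\<delta> < k"
  then have m: "m \<in> indices \<Psi> k" and n: "n \<in> indices \<Phi> k"
    and nz: "fst (assemble X \<omega> \<Phi> \<Psi> k F) m n \<noteq> 0" by auto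
  from nz obtain x where x: "x \<in> grid X k" "tensor \<Phi> k n x \<noteq> 0" "tensor \<Psi> k m x \<noteq> 0"
    unfolding assemble_correct[OF m n] by (force elim: sum.not_neutral_contains_not_neutral)
  have "x \<delta> \<in> X \<delta>" "(\<Phi> \<delta> ! n \<delta>) (x \<delta>) \<noteq> 0" "(\<Psi> \<delta> ! m \<delta>) (x \<delta>) \<noteq> 0"
    using x \<delta> by (auto simp: grid_def tensor_def)
  moreover have "m \<delta> < length (\<Psi> \<delta>)" "n \<delta> < length (\<Phi> \<delta>)"
    using m n \<delta> by (auto simp: indices_def)
  ultimately show "(m \<delta>, n \<delta>) \<in> meeting (I \<delta>) (X \<delta>) (\<Psi> \<delta>) (\<Phi> \<delta>)"
    using assms(2)[OF \<delta>] by (auto simp: meeting_def intro!: csupp_self bexI[of _ "x \<delta>"])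
next
  fix \<delta> assume "\<delta> < k"
  then show "card (meeting (I \<delta>) (X \<delta>) (\<Psi> \<delta>) (\<Phi> \<delta>))
      \<le> overlap (I \<delta>) (X \<delta>) (\<Psi> \<delta>) * length (\<Phi> \<delta>)
        + overlap (I \<delta>) (X \<delta>) (\<Phi> \<delta>) * length (\<Psi> \<delta>)"
    by (subst add.commute) (intro card_meeting_le assms(1))
qed (auto simp: finite_meeting)

lemma csupp_box_tensorD:
  assumes "z \<in> csupp_box d D (tensor \<Phi> d i)" "\<delta> < d"
  shows "z \<delta> \<in> csupp (side D \<delta>) (\<Phi> \<delta> ! i \<delta>)"
proof -
  obtain \<alpha> x y where z: "z = (\<lambda>\<delta>\<in>{..<d}. \<alpha> * x \<delta> + (1 - \<alpha>) * y \<delta>)"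
    and xy: "x \<in> D" "y \<in> D" "tensor \<Phi> d i x \<noteq> 0" "tensor \<Phi> d i y \<noteq> 0" and \<alpha>: "0 \<le> \<alpha>" "\<alpha> \<le> 1"
    using assms(1) unfolding csupp_box_def by blast
  have "x \<delta> \<in> side D \<delta>" "y \<delta> \<in> side D \<delta>"
    "(\<Phi> \<delta> ! i \<delta>) (x \<delta>) \<noteq> 0" "(\<Phi> \<delta> ! i \<delta>) (y \<delta>) \<noteq> 0"
    using xy assms(2) by (auto simp: side_def tensor_def)
  then show ?thesis
    unfolding csupp_def z using \<alpha> assms(2) by auto
qed

lemma card_interacting_le:
  assumes "\<And>\<delta>. \<delta> < d \<Longrightarrow> finite (quad S D \<delta>)"
  shows "card (interacting d S D)
    \<le> (\<Prod>\<delta><d. q_loc S D \<delta> * length (locPhi S D \<delta>) + p_loc S D \<delta> * length (locPsi S D \<delta>))"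
proof (rule card_index_pairs_le)
  show "interacting d S D \<subseteq> indices (locPhi S D) d \<times> indices (locPsi S D) d"
    by (auto simp: interacting_def)
next
  fix n m \<delta>
  assume nm: "(n, m) \<in> interacting d S D" and \<delta>: "\<delta> < d"
  then obtain z where "z \<in> grid (quad S D) d" "z \<in> csupp_box d D (tensor (locPhi S D) d n)"
    "z \<in> csupp_box d D (tensor (locPsi S D) d m)"
    unfolding interacting_def by blast
  then have "z \<delta> \<in> quad S D \<delta>" "z \<delta> \<in> csupp (side D \<delta>) (locPhi S D \<delta> ! n \<delta>)"
    "z \<delta> \<in> csupp (side D \<delta>) (locPsi S D \<delta> ! m \<delta>)"
    using \<delta> csupp_box_tensorD by (auto simp: grid_def)
  then show "(n \<delta>, m \<delta>)
      \<in> meeting (side D \<delta>) (quad S D \<delta>) (locPhi S D \<delta>) (locPsi S D \<delta>)"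
    using nm \<delta> by (auto simp: meeting_def interacting_def indices_def)
next
  fix \<delta> assume "\<delta> < d"
  then show "card (meeting (side D \<delta>) (quad S D \<delta>) (locPhi S D \<delta>) (locPsi S D \<delta>))
      \<le> q_loc S D \<delta> * length (locPhi S D \<delta>) + p_loc S D \<delta> * length (locPsi S D \<delta>)"
    unfolding p_loc_def q_loc_def by (intro card_meeting_le assms)
qed (rule finite_meeting)

section \<open>The cost on one box\<close>

definition sweep :: "nat \<Rightarrow> (nat \<Rightarrow> real) \<Rightarrow> (nat \<Rightarrow> real) \<Rightarrow> real" where
  "sweep d x v = (\<Sum>k<d. (\<Prod>\<delta>\<in>{k..<d}. x \<delta>) * (\<Prod>\<delta><k. v \<delta>))"

text \<open>
  This is the recursion of both algorithms: for each point of the last direction, one problem of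
  lower dimension and one update by its result.
\<close>

lemma sweep_Suc: "sweep (Suc d) x v = x d * (sweep d x v + (\<Prod>\<delta><d. v \<delta>))"
proof -
  have "(\<Prod>\<delta>\<in>{k..<Suc d}. x \<delta>) = x d * (\<Prod>\<delta>\<in>{k..<d}. x \<delta>)" if "k < d" for k
    using that by (simp add: prod.atLeastLessThan_Suc mult.commute)
  then have "(\<Sum>k<d. (\<Prod>\<delta>\<in>{k..<Suc d}. x \<delta>) * (\<Prod>\<delta><k. v \<delta>))
      = x d * (\<Sum>k<d. (\<Prod>\<delta>\<in>{k..<d}. x \<delta>) * (\<Prod>\<delta><k. v \<delta>))"
    unfolding sum_distrib_left by (intro sum.cong) (auto simp: mult_ac)
  then show ?thesis
    by (simp add: sweep_def ring_distribs)
qed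

lemma snd_assemble_le:
  fixes P :: nat
  assumes fin: "\<And>\<delta>. \<delta> < k \<Longrightarrow> finite (X \<delta>)" and XI: "\<And>\<delta>. \<delta> < k \<Longrightarrow> X \<delta> \<subseteq> I \<delta>"
    and P: "\<And>\<delta>. \<delta> < k \<Longrightarrow> overlap (I \<delta>) (X \<delta>) (\<Phi> \<delta>) \<le> P"
           "\<And>\<delta>. \<delta> < k \<Longrightarrow> overlap (I \<delta>) (X \<delta>) (\<Psi> \<delta>) \<le> P"
  defines "v \<equiv> \<lambda>\<delta>. overlap (I \<delta>) (X \<delta>) (\<Psi> \<delta>) * length (\<Phi> \<delta>)
                 + overlap (I \<delta>) (X \<delta>) (\<Phi> \<delta>) * length (\<Psi> \<delta>)"
  shows "real (snd (assemble X \<omega> \<Phi> \<Psi> k F))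
    \<le> real P ^ 2 * sweep k (\<lambda>\<delta>. real (card (X \<delta>))) (\<lambda>\<delta>. real (v \<delta>))"
  using fin XI P
proof (induction k arbitrary: F)
  case 0
  then show ?case by (simp add: sweep_def)
next
  case (Suc k)
  let ?rec = "\<lambda>x. assemble X \<omega> \<Phi> \<Psi> k (\<lambda>y. F (y(k := x)))"
  let ?b = "real P ^ 2 * (sweep k (\<lambda>\<delta>. real (card (X \<delta>))) (\<lambda>\<delta>. real (v \<delta>))
              + (\<Prod>\<delta><k. real (v \<delta>)))"
  have "real (snd (?rec x)
      + card (active (\<Psi> k) x \<times> active (\<Phi> k) x) * nnz \<Phi> \<Psi> k (fst (?rec x))) \<le> ?b"
    if x: "x \<in> X k" for x
  proof -
    have IH: "real (snd (?rec x))
        \<le> real P ^ 2 * sweep k (\<lambda>\<delta>. real (card (X \<delta>))) (\<lambda>\<delta>. real (v \<delta>))"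
      using Suc.prems by (intro Suc.IH) auto
    have "card (active \<phi> x) \<le> P" if "overlap (I k) (X k) \<phi> \<le> P" for \<phi>
      by (rule order_trans[OF card_active_le_overlap that]) (use Suc.prems x in auto)
    then have "card (active (\<Psi> k) x) \<le> P" "card (active (\<Phi> k) x) \<le> P"
      using Suc.prems by simp_all
    then have "card (active (\<Psi> k) x \<times> active (\<Phi> k) x) \<le> P ^ 2"
      by (simp add: card_cartesian_product power2_eq_square mult_mono)
    moreover have "nnz \<Phi> \<Psi> k (fst (?rec x)) \<le> (\<Prod>\<delta><k. v \<delta>)"
      unfolding v_def using Suc.prems by (intro nnz_assemble_le) auto
    ultimately have "card (active (\<Psi> k) x \<times> active (\<Phi> k) x) * nnz \<Phi> \<Psi> k (fst (?rec x))
        \<le> P ^ 2 * (\<Prod>\<delta><k. v \<delta>)"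
      by (intro mult_mono) auto
    then have "real (card (active (\<Psi> k) x \<times> active (\<Phi> k) x) * nnz \<Phi> \<Psi> k (fst (?rec x)))
        \<le> real (P ^ 2 * (\<Prod>\<delta><k. v \<delta>))"
      by (simp only: of_nat_le_iff)
    then show ?thesis
      using IH by (simp add: ring_distribs)
  qed
  then have "(\<Sum>x\<in>X k. real (snd (?rec x)
      + card (active (\<Psi> k) x \<times> active (\<Phi> k) x) * nnz \<Phi> \<Psi> k (fst (?rec x))))
      \<le> real (card (X k)) * ?b"
    by (rule sum_bounded_above)
  then show ?case
    by (simp add: Let_def sweep_Suc mult_ac)
qed

lemma snd_apply_sf_le:
  fixes P :: nat
  assumes fin: "\<And>\<delta>. \<delta> < k \<Longrightarrow> finite (X \<delta>)" and XI: "\<And>\<delta>. \<delta> < k \<Longrightarrow> X \<delta> \<subseteq> I \<delta>"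
    and P: "\<And>\<delta>. \<delta> < k \<Longrightarrow> overlap (I \<delta>) (X \<delta>) (\<Psi> \<delta>) \<le> P"
  shows "real (snd (apply_sf X \<omega> \<Psi> k G))
    \<le> real P * sweep k (\<lambda>\<delta>. real (card (X \<delta>))) (\<lambda>\<delta>. real (length (\<Psi> \<delta>)))"
  using fin XI P
proof (induction k arbitrary: G)
  case 0
  then show ?case by (simp add: sweep_def)
next
  case (Suc k)
  let ?rec = "\<lambda>x. apply_sf X \<omega> \<Psi> k (\<lambda>y. G (y(k := x)))"
  let ?b = "real P * (sweep k (\<lambda>\<delta>. real (card (X \<delta>))) (\<lambda>\<delta>. real (length (\<Psi> \<delta>)))
              + (\<Prod>\<delta><k. real (length (\<Psi> \<delta>))))"
  have "real (snd (?rec x) + card (active (\<Psi> k) x) * card (indices \<Psi> k)) \<le> ?b"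
    if x: "x \<in> X k" for x
  proof -
    have IH: "real (snd (?rec x))
        \<le> real P * sweep k (\<lambda>\<delta>. real (card (X \<delta>))) (\<lambda>\<delta>. real (length (\<Psi> \<delta>)))"
      using Suc.prems by (intro Suc.IH) auto
    have "card (active (\<Psi> k) x) \<le> P"
      by (rule order_trans[OF card_active_le_overlap[of "X k" "I k"]]) (use Suc.prems x in auto)
    then have "real (card (active (\<Psi> k) x) * card (indices \<Psi> k))
        \<le> real P * (\<Prod>\<delta><k. real (length (\<Psi> \<delta>)))"
      by (simp add: card_indices mult_right_mono prod_nonneg)
    then show ?thesis
      using IH by (simp add: ring_distribs)
  qed
  then have "(\<Sum>x\<in>X k. real (snd (?rec x) + card (active (\<Psi> k) x) * card (indices \<Psi> k)))
      \<le> real (card (X k)) * ?b"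
    by (rule sum_bounded_above)
  then show ?case
    by (simp add: Let_def sweep_Suc mult_ac)
qed

section \<open>Comparison with a common size in each direction\<close>

lemma prod_le_power_mult:
  fixes a t :: "nat \<Rightarrow> real"
  assumes "finite A" "\<And>\<delta>. \<delta> \<in> A \<Longrightarrow> 0 \<le> a \<delta>" "\<And>\<delta>. \<delta> \<in> A \<Longrightarrow> a \<delta> \<le> B * t \<delta>"
  shows "(\<Prod>\<delta>\<in>A. a \<delta>) \<le> B ^ card A * (\<Prod>\<delta>\<in>A. t \<delta>)"
proof -
  have "(\<Prod>\<delta>\<in>A. a \<delta>) \<le> (\<Prod>\<delta>\<in>A. B * t \<delta>)"
    using assms by (intro prod_mono) auto
  then show ?thesis
    by (simp add: prod.distrib)
qed

lemma sweep_le: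
  fixes K P :: real
  assumes P: "P \<ge> 1" and K: "K \<ge> 0"
    and x: "\<And>\<delta>. \<delta> < d \<Longrightarrow> 0 \<le> x \<delta> \<and> x \<delta> \<le> K * P ^ \<alpha> * t \<delta>"
    and v: "\<And>\<delta>. \<delta> < d \<Longrightarrow> 0 \<le> v \<delta> \<and> v \<delta> \<le> K * P ^ \<beta> * t \<delta>"
    and t: "\<And>\<delta>. \<delta> < d \<Longrightarrow> 0 \<le> t \<delta>"
    and s: "\<And>k. k < d \<Longrightarrow> \<alpha> * (d - k) + \<beta> * k \<le> s"
  shows "sweep d x v \<le> real d * (K ^ d * P ^ s * (\<Prod>\<delta><d. t \<delta>))"
proof -
  have "(\<Prod>\<delta>\<in>{k..<d}. x \<delta>) * (\<Prod>\<delta><k. v \<delta>) \<le> K ^ d * P ^ s * (\<Prod>\<delta><d. t \<delta>)"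
    if k: "k < d" for k
  proof -
    have "(\<Prod>\<delta>\<in>{k..<d}. x \<delta>) \<le> (K * P ^ \<alpha>) ^ card {k..<d} * (\<Prod>\<delta>\<in>{k..<d}. t \<delta>)"
      using x by (intro prod_le_power_mult) auto
    moreover have "(\<Prod>\<delta><k. v \<delta>) \<le> (K * P ^ \<beta>) ^ card {..<k} * (\<Prod>\<delta><k. t \<delta>)"
      using v k by (intro prod_le_power_mult) auto
    ultimately have "(\<Prod>\<delta>\<in>{k..<d}. x \<delta>) * (\<Prod>\<delta><k. v \<delta>)
        \<le> ((K * P ^ \<alpha>) ^ (d - k) * (\<Prod>\<delta>\<in>{k..<d}. t \<delta>))
          * ((K * P ^ \<beta>) ^ k * (\<Prod>\<delta><k. t \<delta>))"
      using v k t P K by (intro mult_mono) (auto intro!: prod_nonneg mult_nonneg_nonneg)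
    also have "\<dots> = K ^ (d - k + k) * P ^ (\<alpha> * (d - k) + \<beta> * k)
        * ((\<Prod>\<delta><k. t \<delta>) * (\<Prod>\<delta>\<in>{k..<d}. t \<delta>))"
      by (simp add: power_mult_distrib power_add power_mult)
    also have "(\<Prod>\<delta><k. t \<delta>) * (\<Prod>\<delta>\<in>{k..<d}. t \<delta>) = (\<Prod>\<delta><d. t \<delta>)"
      using k prod.atLeastLessThan_concat[of 0 k d t] by (simp add: lessThan_atLeast0)
    also have "d - k + k = d"
      using k by simp
    also have "K ^ d * P ^ (\<alpha> * (d - k) + \<beta> * k) * (\<Prod>\<delta><d. t \<delta>)
        \<le> K ^ d * P ^ s * (\<Prod>\<delta><d. t \<delta>)"
      using P K t s[OF k]
      by (intro mult_right_mono mult_left_mono power_increasing prod_nonneg) auto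
    finally show ?thesis .
  qed
  then have "sweep d x v \<le> real (card {..<d}) * (K ^ d * P ^ s * (\<Prod>\<delta><d. t \<delta>))"
    unfolding sweep_def by (intro sum_bounded_above) auto
  then show ?thesis by simp
qed

text \<open>
  The accumulation cost of a box is, up to a constant, the term \<open>k = d\<close> that is missing in
  \<open>sweep\<close>, which explains the extra condition on \<open>\<beta>\<close>.
\<close>

lemma localized_cost_le:
  fixes K P c :: real
  assumes P: "P \<ge> 1" and K: "K \<ge> 0" and c: "c \<ge> 0"
    and x: "\<And>D \<delta>. D \<in> \<B> \<Longrightarrow> \<delta> < d \<Longrightarrow> 0 \<le> x D \<delta> \<and> x D \<delta> \<le> K * P ^ \<alpha> * t D \<delta>"
    and v: "\<And>D \<delta>. D \<in> \<B> \<Longrightarrow> \<delta> < d \<Longrightarrow> 0 \<le> v D \<delta> \<and> v D \<delta> \<le> K * P ^ \<beta> * t D \<delta>"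
    and t: "\<And>D \<delta>. D \<in> \<B> \<Longrightarrow> \<delta> < d \<Longrightarrow> 0 \<le> t D \<delta>"
    and s: "\<And>k. k < d \<Longrightarrow> \<alpha> * (d - k) + \<beta> * k \<le> s" and \<beta>: "\<beta> * d \<le> e + s"
    and work: "\<And>D. D \<in> \<B> \<Longrightarrow> W D \<le> P ^ e * sweep d (x D) (v D)"
    and acc: "acc \<le> c * (\<Sum>D\<in>\<B>. \<Prod>\<delta><d. v D \<delta>)"
  shows "(\<Sum>D\<in>\<B>. W D) + acc
    \<le> (real d + c) * K ^ d * (P ^ (e + s) * (\<Sum>D\<in>\<B>. \<Prod>\<delta><d. t D \<delta>))"
proof -
  let ?T = "\<lambda>D. K ^ d * P ^ (e + s) * (\<Prod>\<delta><d. t D \<delta>)"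
  have W: "W D \<le> real d * ?T D" if D: "D \<in> \<B>" for D
  proof -
    have "sweep d (x D) (v D) \<le> real d * (K ^ d * P ^ s * (\<Prod>\<delta><d. t D \<delta>))"
      by (rule sweep_le[OF P K x[OF D] v[OF D] t[OF D] s])
    then have "P ^ e * sweep d (x D) (v D)
        \<le> P ^ e * (real d * (K ^ d * P ^ s * (\<Prod>\<delta><d. t D \<delta>)))"
      using P by (intro mult_left_mono) auto
    then show ?thesis
      using work[OF D] by (simp add: power_add mult_ac)
  qed
  have V: "(\<Prod>\<delta><d. v D \<delta>) \<le> ?T D" if D: "D \<in> \<B>" for D
  proof -
    have "(\<Prod>\<delta><d. v D \<delta>) \<le> (K * P ^ \<beta>) ^ card {..<d} * (\<Prod>\<delta><d. t D \<delta>)"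
      using v[OF D] by (intro prod_le_power_mult) auto
    also have "\<dots> = K ^ d * P ^ (\<beta> * d) * (\<Prod>\<delta><d. t D \<delta>)"
      by (simp add: power_mult_distrib power_mult)
    also have "\<dots> \<le> ?T D"
      using P K t[OF D] \<beta>
      by (intro mult_right_mono mult_left_mono power_increasing prod_nonneg) auto
    finally show ?thesis .
  qed
  have "acc \<le> c * (\<Sum>D\<in>\<B>. ?T D)"
    using acc c V by (meson mult_left_mono order_trans sum_mono)
  moreover have "(\<Sum>D\<in>\<B>. W D) \<le> real d * (\<Sum>D\<in>\<B>. ?T D)"
    unfolding sum_distrib_left by (intro sum_mono W)
  moreover have "(\<Sum>D\<in>\<B>. ?T D) = K ^ d * (P ^ (e + s) * (\<Sum>D\<in>\<B>. \<Prod>\<delta><d. t D \<delta>))"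
    by (simp add: sum_distrib_left mult.assoc)
  ultimately show ?thesis
    by (simp add: ring_distribs mult.assoc)
qed

section \<open>Total costs\<close>

lemma loc_le_p_max:
  assumes "admissible d S" "D \<in> boxes S" "\<delta> < d"
  shows "p_loc S D \<delta> \<le> p_max d S" "q_loc S D \<delta> \<le> p_max d S"
proof -
  let ?g = "\<lambda>D \<delta>. max (p_loc S D \<delta>) (q_loc S D \<delta>)"
  have "?g D \<delta> \<le> (SUP \<delta>\<in>{..<d}. ?g D \<delta>)"
    using assms by (intro cSUP_upper bdd_above_finite) auto
  also have "\<dots> \<le> p_max d S"
    unfolding p_max_def using assms
    by (intro cSUP_upper[where f = "\<lambda>D. SUP \<delta>\<in>{..<d}. ?g D \<delta>"] bdd_above_finite)
       (auto simp: admissible_def)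
  finally show "p_loc S D \<delta> \<le> p_max d S" "q_loc S D \<delta> \<le> p_max d S" by auto
qed

lemma cost_assemble_le:
  fixes K c :: real
  assumes adm: "admissible d S" and acc: "acc_assemble_bound c d S acc"
    and K: "K \<ge> 0" and c: "c \<ge> 0"
    and x: "\<And>D \<delta>. D \<in> boxes S \<Longrightarrow> \<delta> < d \<Longrightarrow>
      real (card (quad S D \<delta>)) \<le> K * real (p_max d S) ^ \<alpha> * real (t D \<delta>)"
    and v: "\<And>D \<delta>. D \<in> boxes S \<Longrightarrow> \<delta> < d \<Longrightarrow>
      real (q_loc S D \<delta> * length (locPhi S D \<delta>) + p_loc S D \<delta> * length (locPsi S D \<delta>))
        \<le> K * real (p_max d S) ^ \<beta> * real (t D \<delta>)"
    and s: "\<And>k. k < d \<Longrightarrow> \<alpha> * (d - k) + \<beta> * k \<le> s" and \<beta>: "\<beta> * d \<le> 2 + s"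
  shows "real (cost_assemble d S F acc)
    \<le> (real d + c) * K ^ d *
        (real (p_max d S) ^ (2 + s) * (\<Sum>D\<in>boxes S. \<Prod>\<delta><d. real (t D \<delta>)))"
proof -
  let ?v = "\<lambda>D \<delta>. q_loc S D \<delta> * length (locPhi S D \<delta>) + p_loc S D \<delta> * length (locPsi S D \<delta>)"
  have P: "real (p_max d S) \<ge> 1"
    using adm by (simp add: admissible_def)
  have quad: "finite (quad S D \<delta>)" "quad S D \<delta> \<subseteq> side D \<delta>" if "D \<in> boxes S" "\<delta> < d" for D \<delta>
    using adm that by (auto simp: admissible_def)
  have work: "real (snd (loc_assemble d S F D))
      \<le> real (p_max d S) ^ 2 * sweep d (\<lambda>\<delta>. real (card (quad S D \<delta>))) (\<lambda>\<delta>. real (?v D \<delta>))"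
    if D: "D \<in> boxes S" for D
    unfolding loc_assemble_def p_loc_def q_loc_def
    using quad[OF D] loc_le_p_max[OF adm D]
    by (intro snd_assemble_le) (auto simp: p_loc_def q_loc_def)
  have "real (card (interacting d S D)) \<le> (\<Prod>\<delta><d. real (?v D \<delta>))" if D: "D \<in> boxes S" for D
    unfolding of_nat_prod[symmetric] of_nat_le_iff
    by (rule card_interacting_le) (rule quad(1)[OF D])
  then have "(\<Sum>D\<in>boxes S. real (card (interacting d S D)))
      \<le> (\<Sum>D\<in>boxes S. \<Prod>\<delta><d. real (?v D \<delta>))"
    by (rule sum_mono)
  then have acc': "real acc \<le> c * (\<Sum>D\<in>boxes S. \<Prod>\<delta><d. real (?v D \<delta>))"
    using acc c unfolding acc_assemble_bound_def by (meson mult_left_mono order_trans)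
  have "(\<Sum>D\<in>boxes S. real (snd (loc_assemble d S F D))) + real acc
      \<le> (real d + c) * K ^ d *
        (real (p_max d S) ^ (2 + s) * (\<Sum>D\<in>boxes S. \<Prod>\<delta><d. real (t D \<delta>)))"
    using x v by (intro localized_cost_le[OF P K c _ _ _ s \<beta> work acc']) auto
  then show ?thesis
    by (simp add: cost_assemble_def)
qed

lemma cost_apply_le:
  fixes K c :: real
  assumes adm: "admissible d S" and acc: "acc_apply_bound c d S acc"
    and K: "K \<ge> 0" and c: "c \<ge> 0"
    and x: "\<And>D \<delta>. D \<in> boxes S \<Longrightarrow> \<delta> < d \<Longrightarrow>
      real (card (quad S D \<delta>)) \<le> K * real (p_max d S) ^ \<alpha> * real (t D \<delta>)"
    and v: "\<And>D \<delta>. D \<in> boxes S \<Longrightarrow> \<delta> < d \<Longrightarrow>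
      real (length (locPsi S D \<delta>)) \<le> K * real (p_max d S) ^ \<beta> * real (t D \<delta>)"
    and s: "\<And>k. k < d \<Longrightarrow> \<alpha> * (d - k) + \<beta> * k \<le> s" and \<beta>: "\<beta> * d \<le> 1 + s"
  shows "real (cost_apply d S F u acc)
    \<le> (real d + c) * K ^ d *
        (real (p_max d S) ^ (1 + s) * (\<Sum>D\<in>boxes S. \<Prod>\<delta><d. real (t D \<delta>)))"
proof -
  have P: "real (p_max d S) \<ge> 1"
    using adm by (simp add: admissible_def)
  have quad: "finite (quad S D \<delta>)" "quad S D \<delta> \<subseteq> side D \<delta>" if "D \<in> boxes S" "\<delta> < d" for D \<delta>
    using adm that by (auto simp: admissible_def)
  have work: "real (snd (loc_apply d S F u D)) \<le> real (p_max d S) ^ 1 *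
      sweep d (\<lambda>\<delta>. real (card (quad S D \<delta>))) (\<lambda>\<delta>. real (length (locPsi S D \<delta>)))"
    if D: "D \<in> boxes S" for D
    unfolding loc_apply_def power_one_right
    using quad[OF D] loc_le_p_max[OF adm D]
    by (intro snd_apply_sf_le[where I = "side D"]) (auto simp: q_loc_def)
  have acc': "real acc \<le> c * (\<Sum>D\<in>boxes S. \<Prod>\<delta><d. real (length (locPsi S D \<delta>)))"
    using acc by (simp add: acc_apply_bound_def dimPsi_def)
  have "(\<Sum>D\<in>boxes S. real (snd (loc_apply d S F u D))) + real acc
      \<le> (real d + c) * K ^ d *
        (real (p_max d S) ^ (1 + s) * (\<Sum>D\<in>boxes S. \<Prod>\<delta><d. real (t D \<delta>)))"
    using x v by (intro localized_cost_le[OF P K c _ _ _ s \<beta> work acc']) auto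
  then show ?thesis
    by (simp add: cost_apply_def)
qed

lemma sum_dim_le_rep_ratio:
  assumes "admissible d S"
  shows "(\<Sum>D\<in>boxes S. \<Prod>\<delta><d. real (length (locPhi S D \<delta>)))
           \<le> rep_ratio d S * real (length (Phi S))"
    and "(\<Sum>D\<in>boxes S. \<Prod>\<delta><d. real (length (locPsi S D \<delta>)))
           \<le> rep_ratio d S * real (length (Psi S))"
proof -
  have le: "s \<le> max r r' * n" "s \<le> max r' r * n" if "r = 1 / n * s" "n \<ge> 1" for s r r' n :: real
  proof -
    have "s = r * n" using that by simp
    also have "r * n \<le> max r r' * n" using that by (intro mult_right_mono) auto
    finally show "s \<le> max r r' * n" "s \<le> max r' r * n" by (simp_all add: max.commute)
  qed
  have n: "real (length (Phi S)) \<ge> 1" "real (length (Psi S)) \<ge> 1"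
    using assms by (auto simp: admissible_def)
  show "(\<Sum>D\<in>boxes S. \<Prod>\<delta><d. real (length (locPhi S D \<delta>)))
      \<le> rep_ratio d S * real (length (Phi S))"
    unfolding rep_ratio_def by (rule le(1)[OF _ n(1)]) (simp add: dimPhi_def)
  show "(\<Sum>D\<in>boxes S. \<Prod>\<delta><d. real (length (locPsi S D \<delta>)))
      \<le> rep_ratio d S * real (length (Psi S))"
    unfolding rep_ratio_def by (rule le(2)[OF _ n(2)]) (simp add: dimPsi_def)
qed

lemma meeting_size_le:
  fixes c :: real
  assumes adm: "admissible d S" "D \<in> boxes S" "\<delta> < d"
    and c: "real (length (locPsi S D \<delta>)) \<le> c * real (length (locPhi S D \<delta>))"
  shows "real (q_loc S D \<delta> * length (locPhi S D \<delta>) + p_loc S D \<delta> * length (locPsi S D \<delta>))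
    \<le> (1 + c) * real (p_max d S) * real (length (locPhi S D \<delta>))"
proof -
  have "real (q_loc S D \<delta>) * real (length (locPhi S D \<delta>))
      \<le> real (p_max d S) * real (length (locPhi S D \<delta>))"
    using loc_le_p_max[OF adm] by (intro mult_right_mono) auto
  moreover have "real (p_loc S D \<delta>) * real (length (locPsi S D \<delta>))
      \<le> real (p_max d S) * (c * real (length (locPhi S D \<delta>)))"
    using loc_le_p_max[OF adm] c by (intro mult_mono) auto
  ultimately show ?thesis
    by (simp add: ring_distribs mult_ac)
qed

lemma real_card_grid: "real (card (grid X d)) = (\<Prod>\<delta><d. real (card (X \<delta>)))"
  by (simp add: grid_def card_PiE)

theorem mainTheorem3:
  fixes d :: nat and c_acc c_MN c_X :: real
  assumes "d \<ge> 1" and "c_acc > 0" and "c_MN > 0" and "c_X > 0"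
  shows
   "(\<exists>C>0. \<forall>S F acc.
       admissible d S \<and> acc_assemble_bound c_acc d S acc \<and>
       (\<forall>D\<in>boxes S. \<forall>\<delta><d.
          real (length (locPsi S D \<delta>)) \<le> c_MN * real (length (locPhi S D \<delta>))) \<and>
       (\<forall>D\<in>boxes S. \<forall>\<delta><d.
          real (card (quad S D \<delta>)) \<le> c_X * real (q_loc S D \<delta> * length (locPhi S D \<delta>)
                                               + p_loc S D \<delta> * length (locPsi S D \<delta>)))
       \<longrightarrow> real (cost_assemble d S F acc)
             \<le> C * (rep_ratio d S * real (p_max d S) ^ (d + 2) * real (length (Phi S))))
  \<and> (\<exists>C>0. \<forall>S F acc.
       admissible d S \<and> acc_assemble_bound c_acc d S acc \<and>
       (\<forall>D\<in>boxes S. \<forall>\<delta><d.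
          real (length (locPsi S D \<delta>)) \<le> c_MN * real (length (locPhi S D \<delta>))) \<and>
       (\<forall>D\<in>boxes S. \<forall>\<delta><d.
          real (card (quad S D \<delta>)) \<le> c_X * real (length (locPhi S D \<delta>)))
       \<longrightarrow> real (cost_assemble d S F acc)
             \<le> C * (rep_ratio d S * real (p_max d S) ^ (d + 1) * real (length (Phi S))))
  \<and> (\<exists>C>0. \<forall>S F acc.
       admissible d S \<and> acc_assemble_bound c_acc d S acc \<and>
       (\<forall>D\<in>boxes S. \<forall>\<delta><d.
          real (length (locPsi S D \<delta>)) \<le> c_MN * real (length (locPhi S D \<delta>))) \<and>
       (\<forall>D\<in>boxes S. \<forall>\<delta><d.
          real (q_loc S D \<delta> * length (locPhi S D \<delta>)
                + p_loc S D \<delta> * length (locPsi S D \<delta>)) \<le> c_X * real (card (quad S D \<delta>)))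
       \<longrightarrow> real (cost_assemble d S F acc)
             \<le> C * (real (p_max d S) ^ 2 * (\<Sum>D\<in>boxes S. real (card (grid (quad S D) d)))))
  \<and> (\<exists>C>0. \<forall>S F u acc.
       admissible d S \<and> acc_apply_bound c_acc d S acc \<and>
       (\<forall>D\<in>boxes S. \<forall>\<delta><d.
          real (card (quad S D \<delta>)) \<le> c_X * real (p_max d S * length (locPsi S D \<delta>)))
       \<longrightarrow> real (cost_apply d S F u acc)
             \<le> C * (rep_ratio d S * real (p_max d S) ^ (d + 1) * real (length (Psi S))))
  \<and> (\<exists>C>0. \<forall>S F u acc.
       admissible d S \<and> acc_apply_bound c_acc d S acc \<and>
       (\<forall>D\<in>boxes S. \<forall>\<delta><d.
          real (card (quad S D \<delta>)) \<le> c_X * real (length (locPsi S D \<delta>)))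
       \<longrightarrow> real (cost_apply d S F u acc)
             \<le> C * (rep_ratio d S * real (p_max d S) * real (length (Psi S))))
  \<and> (\<exists>C>0. \<forall>S F u acc.
       admissible d S \<and> acc_apply_bound c_acc d S acc \<and>
       (\<forall>D\<in>boxes S. \<forall>\<delta><d.
          real (length (locPsi S D \<delta>)) \<le> c_X * real (card (quad S D \<delta>)))
       \<longrightarrow> real (cost_apply d S F u acc)
             \<le> C * (real (p_max d S) * (\<Sum>D\<in>boxes S. real (card (grid (quad S D) d)))))"
proof -
  \<comment> \<open>\<open>K\<close> dominates every constant that occurs when the hypotheses are put into the form
    \<open>\<dots> \<le> K * p ^ \<alpha> * t\<close>, so that one \<open>C\<close> serves all six claims.\<close>
  define K where "K = (1 + c_X) * (1 + c_MN)"
  define C where "C = (real d + c_acc) * K ^ d"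
  have K_ge: "0 \<le> K" "1 \<le> K" "c_X \<le> K" "1 + c_MN \<le> K" "c_X * (1 + c_MN) \<le> K"
    using assms by (simp_all add: K_def ring_distribs)
  have C: "C > 0"
    using assms K_ge by (simp add: C_def)
  note [simp] = less_imp_le[OF assms(2)]
  have K_mult: "a \<le> K * t" if "a \<le> c * t" "c \<le> K" "0 \<le> t" for a c t :: real
    using that by (meson mult_right_mono order_trans)
  let ?N = "\<lambda>S D \<delta>. length (locPhi S D \<delta>)" and ?M = "\<lambda>S D \<delta>. length (locPsi S D \<delta>)"
  let ?X = "\<lambda>S D \<delta>. card (quad S D \<delta>)" and ?P = "\<lambda>S. real (p_max d S)"
  let ?v = "\<lambda>S D \<delta>. q_loc S D \<delta> * ?N S D \<delta> + p_loc S D \<delta> * ?M S D \<delta>"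

  have v_le: "real (?v S D \<delta>) \<le> K * ?P S ^ 1 * real (?N S D \<delta>)"
    if "admissible d S" "D \<in> boxes S" "\<delta> < d"
      and "\<forall>D\<in>boxes S. \<forall>\<delta><d. real (?M S D \<delta>) \<le> c_MN * real (?N S D \<delta>)" for S D \<delta>
    using K_mult[of "real (?v S D \<delta>)" "1 + c_MN" "?P S * real (?N S D \<delta>)"]
      meeting_size_le[OF that(1-3), of c_MN] that K_ge by (simp add: mult.assoc)

  have A1: "real (cost_assemble d S F acc)
      \<le> C * (rep_ratio d S * ?P S ^ (d + 2) * real (length (Phi S)))"
    if S: "admissible d S" "acc_assemble_bound c_acc d S acc"
      and MN: "\<forall>D\<in>boxes S. \<forall>\<delta><d. real (?M S D \<delta>) \<le> c_MN * real (?N S D \<delta>)"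
      and X: "\<forall>D\<in>boxes S. \<forall>\<delta><d. real (?X S D \<delta>) \<le> c_X * real (?v S D \<delta>)" for S F acc
  proof -
    have x: "real (?X S D \<delta>) \<le> K * ?P S ^ 1 * real (?N S D \<delta>)" if D: "D \<in> boxes S" "\<delta> < d" for D \<delta>
    proof -
      have "real (?X S D \<delta>) \<le> c_X * real (?v S D \<delta>)"
        using X D by blast
      also have "\<dots> \<le> c_X * ((1 + c_MN) * ?P S * real (?N S D \<delta>))"
        using MN D assms by (intro mult_left_mono meeting_size_le[OF S(1)]) auto
      finally show ?thesis
        using K_mult[of _ "c_X * (1 + c_MN)" "?P S * real (?N S D \<delta>)"] K_ge
        by (simp add: mult.assoc)
    qed
    have "real (cost_assemble d S F acc)
        \<le> C * (?P S ^ (2 + d) * (\<Sum>D\<in>boxes S. \<Prod>\<delta><d. real (?N S D \<delta>)))"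
      unfolding C_def using v_le[OF S(1) _ _ MN] x K_ge
      by (intro cost_assemble_le[OF S, where \<alpha> = 1 and \<beta> = 1]) auto
    also have "\<dots> \<le> C * (?P S ^ (2 + d) * (rep_ratio d S * real (length (Phi S))))"
      using C by (intro mult_left_mono sum_dim_le_rep_ratio S) auto
    finally show ?thesis by (simp add: mult_ac)
  qed

  have A2: "real (cost_assemble d S F acc)
      \<le> C * (rep_ratio d S * ?P S ^ (d + 1) * real (length (Phi S)))"
    if S: "admissible d S" "acc_assemble_bound c_acc d S acc"
      and MN: "\<forall>D\<in>boxes S. \<forall>\<delta><d. real (?M S D \<delta>) \<le> c_MN * real (?N S D \<delta>)"
      and X: "\<forall>D\<in>boxes S. \<forall>\<delta><d. real (?X S D \<delta>) \<le> c_X * real (?N S D \<delta>)" for S F acc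
  proof -
    have "real (?X S D \<delta>) \<le> K * ?P S ^ 0 * real (?N S D \<delta>)" if "D \<in> boxes S" "\<delta> < d" for D \<delta>
      using X that K_ge K_mult[of "real (?X S D \<delta>)" c_X "real (?N S D \<delta>)"] by simp
    then have "real (cost_assemble d S F acc)
        \<le> C * (?P S ^ (2 + (d - 1)) * (\<Sum>D\<in>boxes S. \<Prod>\<delta><d. real (?N S D \<delta>)))"
      unfolding C_def using v_le[OF S(1) _ _ MN] K_ge
      by (intro cost_assemble_le[OF S, where \<alpha> = 0 and \<beta> = 1]) auto
    also have "\<dots> \<le> C * (?P S ^ (2 + (d - 1)) * (rep_ratio d S * real (length (Phi S))))"
      using C by (intro mult_left_mono sum_dim_le_rep_ratio S) auto
    also have "2 + (d - 1) = d + 1"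
      using assms by simp
    finally show ?thesis by (simp add: mult_ac)
  qed

  have A3: "real (cost_assemble d S F acc)
      \<le> C * (?P S ^ 2 * (\<Sum>D\<in>boxes S. real (card (grid (quad S D) d))))"
    if S: "admissible d S" "acc_assemble_bound c_acc d S acc"
      and X: "\<forall>D\<in>boxes S. \<forall>\<delta><d. real (?v S D \<delta>) \<le> c_X * real (?X S D \<delta>)" for S F acc
  proof -
    have "real (?v S D \<delta>) \<le> K * ?P S ^ 0 * real (?X S D \<delta>)" if "D \<in> boxes S" "\<delta> < d" for D \<delta>
      using X that K_ge K_mult[of "real (?v S D \<delta>)" c_X "real (?X S D \<delta>)"] by simp
    moreover have "real (?X S D \<delta>) \<le> K * ?P S ^ 0 * real (?X S D \<delta>)" for D \<delta>
      using K_ge K_mult[of "real (?X S D \<delta>)" 1] by simp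
    ultimately have "real (cost_assemble d S F acc)
        \<le> C * (?P S ^ (2 + 0) * (\<Sum>D\<in>boxes S. \<Prod>\<delta><d. real (?X S D \<delta>)))"
      unfolding C_def using K_ge
      by (intro cost_assemble_le[OF S, where \<alpha> = 0 and \<beta> = 0]) auto
    then show ?thesis by (simp add: real_card_grid)
  qed

  have M_le: "real (?M S D \<delta>) \<le> K * ?P S ^ 0 * real (?M S D \<delta>)" for S D \<delta>
    using K_ge K_mult[of "real (?M S D \<delta>)" 1] by simp

  have B1: "real (cost_apply d S F u acc)
      \<le> C * (rep_ratio d S * ?P S ^ (d + 1) * real (length (Psi S)))"
    if S: "admissible d S" "acc_apply_bound c_acc d S acc"
      and X: "\<forall>D\<in>boxes S. \<forall>\<delta><d. real (?X S D \<delta>) \<le> c_X * real (p_max d S * ?M S D \<delta>)" for S F u acc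
  proof -
    have "real (?X S D \<delta>) \<le> K * ?P S ^ 1 * real (?M S D \<delta>)" if "D \<in> boxes S" "\<delta> < d" for D \<delta>
      using X that K_ge K_mult[of "real (?X S D \<delta>)" c_X "?P S * real (?M S D \<delta>)"]
      by (simp add: mult.assoc)
    then have "real (cost_apply d S F u acc)
        \<le> C * (?P S ^ (1 + d) * (\<Sum>D\<in>boxes S. \<Prod>\<delta><d. real (?M S D \<delta>)))"
      unfolding C_def using M_le K_ge
      by (intro cost_apply_le[OF S, where \<alpha> = 1 and \<beta> = 0]) auto
    also have "\<dots> \<le> C * (?P S ^ (1 + d) * (rep_ratio d S * real (length (Psi S))))"
      using C by (intro mult_left_mono sum_dim_le_rep_ratio S) auto
    finally show ?thesis by (simp add: mult_ac)
  qed

  have B2: "real (cost_apply d S F u acc)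
      \<le> C * (rep_ratio d S * ?P S * real (length (Psi S)))"
    if S: "admissible d S" "acc_apply_bound c_acc d S acc"
      and X: "\<forall>D\<in>boxes S. \<forall>\<delta><d. real (?X S D \<delta>) \<le> c_X * real (?M S D \<delta>)" for S F u acc
  proof -
    have "real (?X S D \<delta>) \<le> K * ?P S ^ 0 * real (?M S D \<delta>)" if "D \<in> boxes S" "\<delta> < d" for D \<delta>
      using X that K_ge K_mult[of "real (?X S D \<delta>)" c_X "real (?M S D \<delta>)"] by simp
    then have "real (cost_apply d S F u acc)
        \<le> C * (?P S ^ (1 + 0) * (\<Sum>D\<in>boxes S. \<Prod>\<delta><d. real (?M S D \<delta>)))"
      unfolding C_def using M_le K_ge
      by (intro cost_apply_le[OF S, where \<alpha> = 0 and \<beta> = 0]) auto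
    also have "\<dots> \<le> C * (?P S ^ (1 + 0) * (rep_ratio d S * real (length (Psi S))))"
      using C by (intro mult_left_mono sum_dim_le_rep_ratio S) auto
    finally show ?thesis by (simp add: mult_ac)
  qed

  have B3: "real (cost_apply d S F u acc)
      \<le> C * (?P S * (\<Sum>D\<in>boxes S. real (card (grid (quad S D) d))))"
    if S: "admissible d S" "acc_apply_bound c_acc d S acc"
      and X: "\<forall>D\<in>boxes S. \<forall>\<delta><d. real (?M S D \<delta>) \<le> c_X * real (?X S D \<delta>)" for S F u acc
  proof -
    have "real (?M S D \<delta>) \<le> K * ?P S ^ 0 * real (?X S D \<delta>)" if "D \<in> boxes S" "\<delta> < d" for D \<delta>
      using X that K_ge K_mult[of "real (?M S D \<delta>)" c_X "real (?X S D \<delta>)"] by simp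
    moreover have "real (?X S D \<delta>) \<le> K * ?P S ^ 0 * real (?X S D \<delta>)" for D \<delta>
      using K_ge K_mult[of "real (?X S D \<delta>)" 1] by simp
    ultimately have "real (cost_apply d S F u acc)
        \<le> C * (?P S ^ (1 + 0) * (\<Sum>D\<in>boxes S. \<Prod>\<delta><d. real (?X S D \<delta>)))"
      unfolding C_def using K_ge
      by (intro cost_apply_le[OF S, where \<alpha> = 0 and \<beta> = 0]) auto
    then show ?thesis by (simp add: real_card_grid)
  qed

  show ?thesis
    by (intro conjI exI[of _ C] allI impI C; elim conjE)
       (rule A1 A2 A3 B1 B2 B3; assumption)+
qed

end
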